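(* Let $K$ be the Kronecker quiver, let $\mathcal B''(K)$ be the Caldero-Zelevinsky basis of $\mathcal A(K)$ and $\mathcal B'(K)$ the semicanonical basis. There is a positive locally unipotent base change from $\mathcal B''(K)$ to $\mathcal B'(K)$.
   Context: $K$ is the Kronecker quiver (two vertices $1,2$ and two arrows $2\to1$), and $\mathcal A(K)$ is the coefficient-free cluster algebra with initial seed $(K,(u_1,u_2))$. A cluster monomial is a monomial in cluster variables of one same cluster. Let $z=\dfrac{1+u_1^2+u_2^2}{u_1u_2}\in\mathcal A(K)$. Normalized Chebyshev polynomials of the second kind: $C_{-1}=0$, $C_0=1$, $C_{n+1}(x)=xC_n(x)-C_{n-1}(x)$ for $n\ge0$, so that $C_n(t+t^{-1})=\sum_{k=0}^nt^{n-2k}$. The Caldero-Zelevinsky basis is the $\mathbb Z$-basis $\mathcal B''(K)=\{\text{cluster monomials}\}\sqcup\{X_{M_\lambda^{(n)}}:n\ge1\}$ of $\mathcal A(K)$, where $M_\lambda^{(n)}$ is an indecomposable regular representation of $K$ of quasi-length $n$ (dimension vector $(n,n)$) and $X_?$ is the Caldero-Chapoton map; one has $X_{M_\lambda^{(n)}}=C_n(z)$. The semicanonical basis is $\mathcal B'(K)=\{X_{\mathbf d}:\mathbf d\in\mathbb Z^{2}\}=\{\text{cluster monomials}\}\sqcup\{z^n:n\ge1\}$, the set of generic variables, where $X_{\mathbf d}$ is the generic value of the Caldero-Chapoton map on representations of $K$ of dimension $\mathbf d$ for $\mathbf d\in\mathbb N^2$ and $X_{\mathbf d}=X_{[\mathbf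 d]_+}\prod_{d_i<0}u_i^{-d_i}$ with $[\mathbf d]_+=(\max(d_i,0))_i$ in general. For two enumerated bases $\mathfrak a=\{a_n,n\ge0\}$ and $\mathfrak b=\{b_n,n\ge0\}$ of the $\mathbb Z$-module $\mathcal A(K)$, there is a locally unipotent base change from $\mathfrak a$ to $\mathfrak b$ if for every $n\geq 0$ the $\mathbb Z$-modules spanned by $\{a_k,0\le k\le n\}$ and $\{b_k,0\le k\le n\}$ coincide and the base change matrix from $(a_k)_{0\le k\le n}$ to $(b_k)_{0\le k\le n}$ (whose $k$-th column is formed by the coordinates of $b_k$ in $(a_0,\dots,a_n)$) is a unipotent integer matrix. It is positive if moreover these matrices have non-negative entries. For bases given as sets, this means for suitable enumerations of the two sets. *)

theory Defs
  imports
    "HOL-Computational_Algebra.Polynomial"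
    "HOL-Computational_Algebra.Fraction_Field"
    "Jordan_Normal_Form.Matrix"
begin

section \<open>Coefficient-free cluster algebras of quivers\<close>

text \<open>A quiver on a finite vertex type is given by its arrow counts: \<open>Q i j\<close> is the number of
  arrows \<open>i \<rightarrow> j\<close>. For quivers without loops and 2-cycles, mutation of the quiver is the
  Fomin-Zelevinsky mutation of the skew-symmetric matrix below, so seeds carry that matrix.\<close>

type_synonym 'v quiver = "'v \<Rightarrow> 'v \<Rightarrow> nat"

definition exchange_matrix :: "'v quiver \<Rightarrow> 'v \<Rightarrow> 'v \<Rightarrow> int" where
  "exchange_matrix Q i j = int (Q i j) - int (Q j i)"

type_synonym ('v, 'f) seed = "('v \<Rightarrow> 'v \<Rightarrow> int) \<times> ('v \<Rightarrow> 'f)"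

definition mutate_matrix :: "'v \<Rightarrow> ('v \<Rightarrow> 'v \<Rightarrow> int) \<Rightarrow> 'v \<Rightarrow> 'v \<Rightarrow> int" where
  "mutate_matrix k b i j =
     (if i = k \<or> j = k then - b i j
      else b i j + max (b i k) 0 * max (b k j) 0 - max (- b i k) 0 * max (- b k j) 0)"

definition mutate_cluster ::
    "'v \<Rightarrow> ('v \<Rightarrow> 'v \<Rightarrow> int) \<Rightarrow> ('v::finite \<Rightarrow> 'f::field) \<Rightarrow> 'v \<Rightarrow> 'f" where
  "mutate_cluster k b x =
     x(k := ((\<Prod>i\<in>UNIV. x i ^ nat (b i k)) + (\<Prod>i\<in>UNIV. x i ^ nat (- b i k))) / x k)"

definition mutate_seed :: "'v::finite \<Rightarrow> ('v, 'f::field) seed \<Rightarrow> ('v, 'f) seed" where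
  "mutate_seed k S = (mutate_matrix k (fst S), mutate_cluster k (fst S) (snd S))"

inductive_set seeds :: "('v::finite, 'f::field) seed \<Rightarrow> ('v, 'f) seed set"
  for S0 :: "('v, 'f) seed" where
  initial: "S0 \<in> seeds S0"
| mutation: "S \<in> seeds S0 \<Longrightarrow> mutate_seed k S \<in> seeds S0"

definition cluster_variables :: "('v::finite, 'f::field) seed \<Rightarrow> 'f set" where
  "cluster_variables S0 = (\<Union>S\<in>seeds S0. range (snd S))"

definition cluster_monomials :: "('v::finite, 'f::field) seed \<Rightarrow> 'f set" where
  "cluster_monomials S0 = {\<Prod>i\<in>UNIV. snd S i ^ m i | S m. S \<in> seeds S0}"

inductive_set cluster_algebra :: "('v::finite, 'f::field) seed \<Rightarrow> 'f set"
  for S0 :: "('v, 'f) seed" where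
  variable: "x \<in> cluster_variables S0 \<Longrightarrow> x \<in> cluster_algebra S0"
| one: "1 \<in> cluster_algebra S0"
| diff: "x \<in> cluster_algebra S0 \<Longrightarrow> y \<in> cluster_algebra S0 \<Longrightarrow> x - y \<in> cluster_algebra S0"
| mult: "x \<in> cluster_algebra S0 \<Longrightarrow> y \<in> cluster_algebra S0 \<Longrightarrow> x * y \<in> cluster_algebra S0"


section \<open>The Kronecker quiver and the two bases\<close>

datatype vertex = V1 | V2

instance vertex :: finite
proof
  have "(UNIV :: vertex set) \<subseteq> {V1, V2}"
    by (auto intro: vertex.exhaust)
  then show "finite (UNIV :: vertex set)"
    by (rule finite_subset) simp
qed

fun kronecker :: "vertex quiver" where
  "kronecker V2 V1 = 2"
| "kronecker _ _ = 0"

text \<open>The ambient field \<open>\<rat>(u\<^sub>1, u\<^sub>2)\<close>, as the fraction field of \<open>\<rat>[u\<^sub>1][u\<^sub>2]\<close>.\<close>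

type_synonym ratfun2 = "rat poly poly fract"

definition u1 :: ratfun2 where "u1 = Fract [:[:0, 1:]:] 1"

definition u2 :: ratfun2 where "u2 = Fract [:0, 1:] 1"

definition kronecker_seed :: "(vertex, ratfun2) seed" where
  "kronecker_seed = (exchange_matrix kronecker, case_vertex u1 u2)"

definition z :: ratfun2 where "z = (1 + u1\<^sup>2 + u2\<^sup>2) / (u1 * u2)"

text \<open>Normalized Chebyshev polynomials of the second kind; the second equation is the recursion
  at \<open>n = 0\<close> with \<open>C\<^bsub>-1\<^esub> = 0\<close>.\<close>

fun chebyshev :: "nat \<Rightarrow> 'a::comm_ring_1 \<Rightarrow> 'a" where
  "chebyshev 0 x = 1"
| "chebyshev (Suc 0) x = x"
| "chebyshev (Suc (Suc n)) x = x * chebyshev (Suc n) x - chebyshev n x"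

text \<open>The Caldero-Chapoton character of an indecomposable regular representation of quasi-length
  \<open>n\<close> is \<open>C\<^sub>n(z)\<close>, for every parameter \<open>\<lambda>\<close>; the generic variables that are not cluster monomials
  are the powers \<open>z\<^sup>n\<close>, the generic values in dimension \<open>(n, n)\<close>. The two bases are given by these
  explicit elements.\<close>

definition caldero_zelevinsky_basis :: "ratfun2 set" where
  "caldero_zelevinsky_basis =
     cluster_monomials kronecker_seed \<union> {chebyshev n z | n. n \<ge> 1}"

definition semicanonical_basis :: "ratfun2 set" where
  "semicanonical_basis = cluster_monomials kronecker_seed \<union> {z ^ n | n. n \<ge> 1}"


section \<open>Locally unipotent base changes\<close>

interpretation zmod: Modules.module "\<lambda>(k::int) (x::'f::field). of_int k * x"
  by unfold_locales (simp_all add: algebra_simps)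

definition enumerated_basis :: "'f::field set \<Rightarrow> (nat \<Rightarrow> 'f) \<Rightarrow> bool" where
  "enumerated_basis A a \<longleftrightarrow> inj a \<and> zmod.independent (range a) \<and> zmod.span (range a) = A"

definition base_change_matrix :: "(nat \<Rightarrow> 'f::field) \<Rightarrow> (nat \<Rightarrow> 'f) \<Rightarrow> nat \<Rightarrow> int mat" where
  "base_change_matrix a b n =
     mat (Suc n) (Suc n) (\<lambda>(j, k). zmod.representation (a ` {..n}) (b k) (a j))"

definition unipotent_mat :: "int mat \<Rightarrow> bool" where
  "unipotent_mat T \<longleftrightarrow>
     square_mat T \<and> (\<exists>m. (T - 1\<^sub>m (dim_row T)) ^\<^sub>m m = 0\<^sub>m (dim_row T) (dim_row T))"

definition locally_unipotent_base_change ::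
    "'f::field set \<Rightarrow> (nat \<Rightarrow> 'f) \<Rightarrow> (nat \<Rightarrow> 'f) \<Rightarrow> bool" where
  "locally_unipotent_base_change A a b \<longleftrightarrow>
     enumerated_basis A a \<and> enumerated_basis A b \<and>
     (\<forall>n. zmod.span (a ` {..n}) = zmod.span (b ` {..n}) \<and> unipotent_mat (base_change_matrix a b n))"

definition positive_locally_unipotent_base_change ::
    "'f::field set \<Rightarrow> (nat \<Rightarrow> 'f) \<Rightarrow> (nat \<Rightarrow> 'f) \<Rightarrow> bool" where
  "positive_locally_unipotent_base_change A a b \<longleftrightarrow>
     locally_unipotent_base_change A a b \<and>
     (\<forall>n. \<forall>j\<le>n. \<forall>k\<le>n. base_change_matrix a b n $$ (j, k) \<ge> 0)"

end

theory Submission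
  imports Defs "Jordan_Normal_Form.Char_Poly" "HOL-Library.Nat_Bijection"
begin

text \<open>Let \<open>x\<^sub>n\<close> (\<open>n \<in> \<int>\<close>) be the cluster variables, so that \<open>x\<^bsub>n-1\<^esub> + x\<^bsub>n+1\<^esub> = z x\<^sub>n\<close> and
  \<open>x\<^sub>n\<^sup>2 + x\<^bsub>n+1\<^esub>\<^sup>2 + 1 = z x\<^sub>n x\<^bsub>n+1\<^esub>\<close>. The second identity shows that the span of the cluster monomials and
  the powers of \<open>z\<close> is stable under \<open>z\<close>; as every \<open>x\<^sub>m\<close> is a combination of \<open>x\<^sub>n\<close> and \<open>x\<^bsub>n+1\<^esub>\<close> with
  coefficients polynomial in \<open>z\<close>, the span is stable under every \<open>x\<^sub>m\<close>, hence is the whole algebra.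

  For independence, order monomials by total degree and then by the degree in \<open>u\<^sub>2\<close>. The leading
  monomial of \<open>x\<^sub>n\<close> is \<open>u\<^sub>1 t\<^sup>n\<close> and that of \<open>z\<close> is \<open>t\<close>, where \<open>t = u\<^sub>2 / u\<^sub>1\<close> and \<open>x\<^sub>0 = u\<^sub>1\<close>. So a
  cluster monomial \<open>x\<^sub>n\<^sup>i x\<^bsub>n+1\<^esub>\<^sup>j\<close> of degree \<open>d = i + j\<close> leads with \<open>u\<^sub>1\<^sup>d t\<^bsup>nd+j\<^esup>\<close>, and \<open>z\<^sup>n\<close> and \<open>C\<^sub>n(z)\<close>
  lead with \<open>t\<^sup>n\<close>: all exponents are distinct. Given a finite relation, the order is realized by the
  degree in \<open>X\<close> after \<open>u\<^sub>1 = X\<^sup>N\<close>, \<open>u\<^sub>2 = X\<^bsup>N+1\<^esup>\<close> with \<open>N\<close> large.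

  The two bases differ only in \<open>C\<^sub>n(z)\<close> against \<open>z\<^sup>n\<close>, and \<open>z C\<^sub>n = C\<^bsub>n+1\<^esub> + C\<^bsub>n-1\<^esub>\<close> makes the expansion of
  \<open>z\<^sup>n\<close> unitriangular with non-negative coefficients.\<close>

section \<open>Leading exponents\<close>

text \<open>The substitution \<open>u\<^sub>1 = X\<^sup>N\<close>, \<open>u\<^sub>2 = X\<^bsup>N+1\<^esup>\<close>.\<close>

definition weighted :: "nat \<Rightarrow> rat poly poly \<Rightarrow> rat poly" where
  "weighted N p = poly (map_poly (\<lambda>c. c \<circ>\<^sub>p monom 1 N) p) (monom 1 (N + 1))"

lemma weighted_0 [simp]: "weighted N 0 = 0"
  by (simp add: weighted_def)

lemma weighted_pCons: "weighted N (pCons c p) = c \<circ>\<^sub>p monom 1 N + monom 1 (N + 1) * weighted N p"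
  by (cases "p = 0 \<and> c = 0") (auto simp: weighted_def map_poly_pCons)

lemma weighted_add: "weighted N (p + q) = weighted N p + weighted N q"
  by (induction p q rule: poly_induct2) (simp_all add: weighted_pCons pcompose_add algebra_simps)

lemma weighted_smult: "weighted N (Polynomial.smult c p) = (c \<circ>\<^sub>p monom 1 N) * weighted N p"
  by (induction p) (simp_all add: weighted_pCons pcompose_mult algebra_simps)

lemma weighted_mult: "weighted N (p * q) = weighted N p * weighted N q"
  by (induction p) (simp_all add: weighted_pCons weighted_add weighted_smult algebra_simps)

text \<open>The degree valuation at infinity of the substituted fraction. Asking for a suitable
  representative \<open>Fract P Q\<close> avoids extending \<open>weighted\<close> to the whole
  field: it kills \<open>u1 ^ (N + 1) - u2 ^ N\<close>, so some denominators would vanish.\<close>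

definition has_weight :: "nat \<Rightarrow> ratfun2 \<Rightarrow> int \<Rightarrow> bool" where
  "has_weight N w k \<longleftrightarrow> (\<exists>P Q. w = Fract P Q \<and> weighted N P \<noteq> 0 \<and> weighted N Q \<noteq> 0 \<and>
     k = int (degree (weighted N P)) - int (degree (weighted N Q)))"

lemma has_weight_nonzero: "has_weight N w k \<Longrightarrow> w \<noteq> 0"
proof
  assume "has_weight N w k" "w = 0"
  then obtain P Q where PQ: "Fract P Q = 0" "weighted N P \<noteq> 0" "weighted N Q \<noteq> 0"
    unfolding has_weight_def by auto
  then have "P \<noteq> 0" "Q \<noteq> 0" by auto
  with PQ(1) show False by (simp add: Zero_fract_def eq_fract)
qed

lemma has_weight_of_int: "c \<noteq> 0 \<Longrightarrow> has_weight N (of_int c) 0"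
proof -
  assume "c \<noteq> 0"
  have "(of_int c :: ratfun2) = Fract (of_int c) 1"
    by (cases c rule: int_cases2) (simp_all add: Fract_of_nat_eq flip: minus_fract)
  moreover have "weighted N (of_int c) = of_int c"
    by (simp add: of_int_poly weighted_pCons pcompose_pCons)
  moreover have "weighted N 1 = 1"
    by (simp add: one_pCons weighted_pCons)
  ultimately show ?thesis
    using \<open>c \<noteq> 0\<close> unfolding has_weight_def by (intro exI[of _ "of_int c"] exI[of _ 1]) simp
qed

lemma has_weight_1: "has_weight N 1 0"
  using has_weight_of_int[of 1 N] by simp

lemma has_weight_mult: "has_weight N v k \<Longrightarrow> has_weight N w l \<Longrightarrow> has_weight N (v * w) (k + l)"
  unfolding has_weight_def
  apply clarify
  subgoal for P P' Q Q'
    by (intro exI[of _ "P * P'"] exI[of _ "Q * Q'"])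
       (auto simp: weighted_mult degree_mult_eq)
  done

lemma has_weight_divide: "has_weight N v k \<Longrightarrow> has_weight N w l \<Longrightarrow> has_weight N (v / w) (k - l)"
  unfolding has_weight_def
  apply clarify
  subgoal for P P' Q Q'
    by (intro exI[of _ "P * Q'"] exI[of _ "Q * P'"])
       (auto simp: weighted_mult degree_mult_eq)
  done

lemma has_weight_power: "has_weight N w k \<Longrightarrow> has_weight N (w ^ m) (int m * k)"
  by (induction m) (auto simp: has_weight_1 algebra_simps dest: has_weight_mult)

text \<open>Over a common denominator, \<open>P * Q'\<close> has larger degree than
  \<open>P' * Q\<close>, so its top term survives.\<close>

lemma has_weight_add_less:
  assumes "has_weight N v k" "has_weight N w l" "l < k"
  shows "has_weight N (v + w) k"
proof -
  obtain P Q where P: "v = Fract P Q" "weighted N P \<noteq> 0" "weighted N Q \<noteq> 0"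
    "k = int (degree (weighted N P)) - int (degree (weighted N Q))"
    using assms unfolding has_weight_def by blast
  obtain P' Q' where P': "w = Fract P' Q'" "weighted N P' \<noteq> 0" "weighted N Q' \<noteq> 0"
    "l = int (degree (weighted N P')) - int (degree (weighted N Q'))"
    using assms unfolding has_weight_def by blast
  have "Q \<noteq> 0" "Q' \<noteq> 0" using P P' by auto
  then have *: "v + w = Fract (P * Q' + P' * Q) (Q * Q')" using P P' by simp
  have "degree (weighted N P' * weighted N Q) < degree (weighted N P * weighted N Q')"
    using P P' assms(3) by (simp add: degree_mult_eq)
  then have deg: "degree (weighted N (P * Q' + P' * Q)) = degree (weighted N P * weighted N Q')"
    by (simp add: weighted_add weighted_mult degree_add_eq_left)
  \<comment> \<open>As \<open>degree 0 = 0\<close>, knowing the degree does not yet exclude zero;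
    the strict inequality makes the degree positive.\<close>
  moreover have "weighted N (P * Q' + P' * Q) \<noteq> 0"
  proof
    assume "weighted N (P * Q' + P' * Q) = 0"
    with deg have "degree (weighted N P * weighted N Q') = 0" by simp
    with \<open>degree (weighted N P' * weighted N Q) < _\<close> show False by simp
  qed
  ultimately show ?thesis
    unfolding has_weight_def * using P P'
    by (intro exI[of _ "P * Q' + P' * Q"] exI[of _ "Q * Q'"])
       (auto simp: weighted_mult degree_mult_eq)
qed

lemma has_weight_minus: "has_weight N w k \<Longrightarrow> has_weight N (- w) k"
  using has_weight_mult[OF has_weight_of_int[of "- 1" N], of w k] by simp

lemma has_weight_diff_less:
  "has_weight N v k \<Longrightarrow> has_weight N w l \<Longrightarrow> l < k \<Longrightarrow> has_weight N (v - w) k"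
  using has_weight_add_less[of N v k "- w" l] has_weight_minus by simp

text \<open>Distinct weights leave a single dominant summand: each inserted term lies strictly above
  or strictly below the current maximum.\<close>

lemma has_weight_sum:
  assumes "finite J" "J \<noteq> {}" "inj_on v J" "\<And>j. j \<in> J \<Longrightarrow> has_weight N (f j) (v j)"
  shows "has_weight N (sum f J) (Max (v ` J))"
  using assms
proof (induction J rule: finite_ne_induct)
  case (singleton j)
  then show ?case by simp
next
  case (insert j J)
  have IH: "has_weight N (sum f J) (Max (v ` J))" using insert by simp
  have j: "has_weight N (f j) (v j)" using insert by simp
  have "Max (v ` J) \<in> v ` J" using insert by (intro Max_in) auto
  moreover have "v j \<notin> v ` J" using insert.prems(1) insert.hyps by auto
  ultimately have "v j \<noteq> Max (v ` J)" by metis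
  have Max: "Max (v ` insert j J) = max (v j) (Max (v ` J))" using insert by simp
  from \<open>v j \<noteq> Max (v ` J)\<close> consider "v j < Max (v ` J)" | "Max (v ` J) < v j" by linarith
  then show ?case
  proof cases
    case 1
    then have "max (v j) (Max (v ` J)) = Max (v ` J)" by linarith
    with has_weight_add_less[OF IH j 1] insert.hyps Max show ?thesis by (simp add: add.commute)
  next
    case 2
    then have "max (v j) (Max (v ` J)) = v j" by linarith
    with has_weight_add_less[OF j IH 2] insert.hyps Max show ?thesis by simp
  qed
qed

lemma has_weight_u1: "has_weight N u1 (int N)"
  unfolding has_weight_def u1_def
  by (intro exI[of _ "[:[:0, 1:]:]"] exI[of _ 1])
     (simp add: weighted_pCons pcompose_pCons degree_monom_eq one_pCons monom_0)

lemma has_weight_u2: "has_weight N u2 (int N + 1)"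
  unfolding has_weight_def u2_def
  by (intro exI[of _ "[:0, 1:]"] exI[of _ 1])
     (simp add: weighted_pCons pcompose_pCons degree_monom_eq one_pCons monom_0)

text \<open>The term \<open>u2^2\<close> dominates the numerator for every \<open>N\<close>, and
  \<open>2 (N + 1) - (2 N + 1) = 1\<close>.\<close>

lemma has_weight_z: "has_weight N z 1"
proof -
  have "has_weight N (u2\<^sup>2 + u1\<^sup>2) (2 * (int N + 1))"
    using has_weight_add_less[OF has_weight_power[OF has_weight_u2, of N 2]
        has_weight_power[OF has_weight_u1, of N 2]] by simp
  from has_weight_add_less[OF this has_weight_1] have "has_weight N (u2\<^sup>2 + u1\<^sup>2 + 1) (2 * (int N + 1))"
    by simp
  from has_weight_divide[OF this has_weight_mult[OF has_weight_u1 has_weight_u2]] show ?thesis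
    by (simp add: z_def algebra_simps)
qed

lemma has_weight_z_power: "has_weight N (z ^ k) (int k)"
  using has_weight_power[OF has_weight_z] by simp

lemma has_weight_chebyshev: "has_weight N (chebyshev k z) (int k)"
proof (induction k rule: induct_nat_012)
  case (ge2 n)
  from has_weight_diff_less[OF has_weight_mult[OF has_weight_z ge2(2)] ge2(1)] show ?case
    by (simp add: algebra_simps)
qed (auto simp: has_weight_1 has_weight_z)

section \<open>Linear independence from distinct leading exponents\<close>

lemma finite_abs_bound: "finite J \<Longrightarrow> \<exists>N. \<forall>j\<in>J. \<bar>s j :: int\<bar> < int N"
proof (induction J rule: finite_induct)
  case (insert j J)
  then obtain N where "\<forall>j\<in>J. \<bar>s j\<bar> < int N" by blast
  then show ?case
    by (intro exI[of _ "max N (nat (\<bar>s j\<bar> + 1))"]) auto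
qed simp

text \<open>For \<open>N\<close> larger than all \<open>2 \<bar>s j\<bar>\<close> the weights \<open>N * d j + s j\<close> are pairwise distinct, so that
  no cancellation of top terms can occur.\<close>

lemma weights_imp_no_relation:
  fixes f :: "nat \<Rightarrow> ratfun2" and d s :: "nat \<Rightarrow> int"
  assumes weight: "\<And>N j. \<bar>s j\<bar> < int N \<Longrightarrow> has_weight N (f j) (int N * d j + s j)"
    and inj: "inj (\<lambda>j. (d j, s j))"
    and J: "finite J" "(\<Sum>j\<in>J. of_int (c j) * f j) = 0"
  shows "\<forall>j\<in>J. c j = 0"
proof (rule ccontr)
  assume nz: "\<not> (\<forall>j\<in>J. c j = 0)"
  \<comment> \<open>Vanishing coefficients are dropped, since a zero summand has no weight.\<close>
  define I where "I = {j\<in>J. c j \<noteq> 0}"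
  have I: "finite I" "I \<noteq> {}" using nz J by (auto simp: I_def)
  obtain N where N: "\<forall>j\<in>I. \<bar>2 * s j\<bar> < int N" using finite_abs_bound[OF I(1), of "\<lambda>j. 2 * s j"] by blast
  have "inj_on (\<lambda>j. int N * d j + s j) I"
  proof (rule inj_onI)
    fix i j assume ij: "i \<in> I" "j \<in> I" and eq: "int N * d i + s i = int N * d j + s j"
    have "\<bar>2 * s i\<bar> < int N" "\<bar>2 * s j\<bar> < int N" using N ij by auto
    \<comment> \<open>This is what the factor 2 is for: equal weights make \<open>s j - s i\<close>
      a multiple of \<open>N\<close>, and its absolute value is below \<open>N\<close>, so it is
      zero.\<close>
    then have "\<bar>s j - s i\<bar> < int N" by linarith
    moreover have "s j - s i = int N * (d i - d j)" using eq by (simp add: algebra_simps)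
    ultimately have "int N * \<bar>d i - d j\<bar> < int N * 1" by (simp add: abs_mult)
    then have "d i = d j" by (simp only: mult_less_cancel_left) auto
    with eq have "(d i, s i) = (d j, s j)" by simp
    with inj show "i = j" by (blast dest: injD)
  qed
  moreover have "has_weight N (of_int (c j) * f j) (int N * d j + s j)" if "j \<in> I" for j
  proof -
    have "\<bar>s j\<bar> < int N" using N that by fastforce
    from has_weight_mult[OF has_weight_of_int weight[OF this]] that show ?thesis
      by (simp add: I_def)
  qed
  ultimately have "(\<Sum>j\<in>I. of_int (c j) * f j) \<noteq> 0"
    by (rule has_weight_nonzero[OF has_weight_sum[OF I]])
  moreover have "(\<Sum>j\<in>I. of_int (c j) * f j) = (\<Sum>j\<in>J. of_int (c j) * f j)"
    unfolding I_def by (intro sum.mono_neutral_left J) auto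
  ultimately show False using J by simp
qed

section \<open>Clusters of the Kronecker quiver\<close>

fun recurrence :: "ratfun2 \<Rightarrow> ratfun2 \<Rightarrow> nat \<Rightarrow> ratfun2" where
  "recurrence v w 0 = v"
| "recurrence v w (Suc 0) = w"
| "recurrence v w (Suc (Suc n)) = z * recurrence v w (Suc n) - recurrence v w n"

text \<open>Two one-sided recursions are glued along the initial cluster. Negative indices use the
  reflection \<open>n -> 1 - n\<close>, which exchanges \<open>u1\<close> and
  \<open>u2\<close>.\<close>

definition cluster_var :: "int \<Rightarrow> ratfun2" where
  "cluster_var n = (if n \<ge> 0 then recurrence u1 u2 (nat n) else recurrence u2 u1 (nat (1 - n)))"

lemma cluster_var_0: "cluster_var 0 = u1" and cluster_var_1: "cluster_var 1 = u2"
  by (simp_all add: cluster_var_def)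

lemma cluster_var_linear: "cluster_var (n - 1) + cluster_var (n + 1) = z * cluster_var n"
proof -
  consider (pos) m where "n = int (Suc m)" | "n = 0" | (neg) m where "n = - int (Suc m)"
    by (metis int_cases3 gr0_implies_Suc)
  then show ?thesis
  proof cases
    case (pos m)
    then have "nat (n - 1) = m" "nat n = Suc m" "nat (n + 1) = Suc (Suc m)" by auto
    with pos show ?thesis by (simp add: cluster_var_def)
  next
    case 2
    then show ?thesis by (simp add: cluster_var_def numeral_2_eq_2)
  next
    case (neg m)
    then have *: "nat (1 - (n - 1)) = Suc (Suc (Suc m))" "nat (1 - n) = Suc (Suc m)" "nat (1 - (n + 1)) = Suc m"
      by auto
    show ?thesis
    \<comment> \<open>For \<open>m = 0\<close> the neighbour \<open>n + 1 = 0\<close> belongs to the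
      other branch of \<open>cluster_var\<close>.\<close>
    proof (cases m)
      case 0
      with neg show ?thesis by (simp add: cluster_var_def numeral_2_eq_2 numeral_3_eq_3)
    next
      case (Suc k)
      with neg have "n + 1 < 0" by simp
      with neg * show ?thesis by (simp add: cluster_var_def)
    qed
  qed
qed

lemma cluster_var_succ: "cluster_var (n + 1) = z * cluster_var n - cluster_var (n - 1)"
  using cluster_var_linear[of n] by (simp add: algebra_simps)

lemma cluster_var_pred: "cluster_var (n - 1) = z * cluster_var n - cluster_var (n + 1)"
  using cluster_var_linear[of n] by (simp add: algebra_simps)

text \<open>Vieta jumping: \<open>a\<close> and \<open>c\<close> are the two roots of
  \<open>X^2 - t b X + (b^2 + 1)\<close>, with sum \<open>t b\<close> and product
  \<open>b^2 + 1\<close>.\<close>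

lemma quadratic_step:
  fixes a b c t :: "'a::comm_ring_1"
  assumes "a\<^sup>2 + b\<^sup>2 + 1 = t * a * b" and c: "c = t * b - a"
  shows "a * c = b\<^sup>2 + 1" and "b\<^sup>2 + c\<^sup>2 + 1 = t * b * c"
proof -
  have "a * c = t * a * b - a\<^sup>2" by (simp add: c power2_eq_square algebra_simps)
  then show ac: "a * c = b\<^sup>2 + 1" by (simp flip: assms(1))
  have "t * b * c = a * c + c\<^sup>2" by (simp add: c power2_eq_square algebra_simps)
  with ac show "b\<^sup>2 + c\<^sup>2 + 1 = t * b * c" by (simp add: algebra_simps)
qed

text \<open>The base case is the definition of \<open>z\<close>. The relation is symmetric in the
  two variables, so Vieta jumping carries it in both directions.\<close>

lemma cluster_var_quadratic:
  "(cluster_var n)\<^sup>2 + (cluster_var (n + 1))\<^sup>2 + 1 = z * cluster_var n * cluster_var (n + 1)"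
proof (induction n rule: int_induct[where k = 0])
  case base
  have "u1 \<noteq> 0" "u2 \<noteq> 0"
    using has_weight_u1 has_weight_u2 has_weight_nonzero by blast+
  then show ?case by (simp add: cluster_var_0 cluster_var_1 z_def)
next
  case (step1 n)
  have "cluster_var (n + 1 + 1) = z * cluster_var (n + 1) - cluster_var n"
    using cluster_var_succ[of "n + 1"] by simp
  from quadratic_step(2)[OF step1(2) this] show ?case .
next
  case (step2 n)
  then have "(cluster_var (n + 1))\<^sup>2 + (cluster_var n)\<^sup>2 + 1 = z * cluster_var (n + 1) * cluster_var n"
    by (simp add: algebra_simps)
  from quadratic_step(2)[OF this cluster_var_pred] show ?case by (simp add: algebra_simps)
qed

lemma cluster_var_exchange:
  "cluster_var (n - 1) * cluster_var (n + 1) = (cluster_var n)\<^sup>2 + 1"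
  using quadratic_step(1)[OF cluster_var_quadratic[of "n - 1"]] cluster_var_succ[of n] by simp

text \<open>Upwards, \<open>z x_n\<close> dominates \<open>x_(n-1)\<close> in the linear recursion.
  Downwards, \<open>z x_n\<close> and \<open>x_(n+1)\<close> have equal weight and their top terms
  cancel, so the exchange relation is divided instead; the bound on \<open>n\<close> makes
  \<open>x_n^2\<close> dominate 1.\<close>

lemma has_weight_cluster_var:
  assumes "\<bar>n\<bar> < int N"
  shows "has_weight N (cluster_var n) (int N + n)"
proof -
  have *: "has_weight N ((cluster_var n)\<^sup>2 + 1) (2 * (int N + n))"
    if "has_weight N (cluster_var n) (int N + n)" "int N + n > 0" for n
    using has_weight_add_less[OF has_weight_power[OF that(1), of 2] has_weight_1] that(2) by simp
  have "N > 0" using assms by linarith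
  have up: "int m < int N \<Longrightarrow> has_weight N (cluster_var (int m)) (int N + int m) \<and>
      has_weight N (cluster_var (int m + 1)) (int N + int m + 1)" for m
  proof (induction m)
    case 0
    then show ?case by (simp add: cluster_var_0 cluster_var_1 has_weight_u1 has_weight_u2)
  next
    case (Suc m)
    then have IH: "has_weight N (cluster_var (int m)) (int N + int m)"
      "has_weight N (cluster_var (int m + 1)) (int N + int m + 1)" by auto
    have eq: "cluster_var (int (Suc m) + 1) = z * cluster_var (int m + 1) - cluster_var (int m)"
      using cluster_var_succ[of "int m + 1"] by (simp add: algebra_simps)
    show ?case
      using has_weight_diff_less[OF has_weight_mult[OF has_weight_z IH(2)] IH(1)] IH(2)
      unfolding eq by (simp add: algebra_simps)
  qed
  have down: "int m < int N \<Longrightarrow> has_weight N (cluster_var (- int m)) (int N - int m) \<and>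
      has_weight N (cluster_var (1 - int m)) (int N + 1 - int m)" for m
  proof (induction m)
    case 0
    then show ?case by (simp add: cluster_var_0 cluster_var_1 has_weight_u1 has_weight_u2)
  next
    case (Suc m)
    then have IH: "has_weight N (cluster_var (- int m)) (int N - int m)"
      "has_weight N (cluster_var (1 - int m)) (int N + 1 - int m)" by auto
    have "cluster_var (- 1 - int m) * cluster_var (1 - int m) = (cluster_var (- int m))\<^sup>2 + 1"
      using cluster_var_exchange[of "- int m"] by (simp add: minus_diff_commute)
    then have eq: "cluster_var (- 1 - int m) = ((cluster_var (- int m))\<^sup>2 + 1) / cluster_var (1 - int m)"
      using has_weight_nonzero[OF IH(2)] by (simp add: field_simps)
    show ?case
      using has_weight_divide[OF *[of "- int m"] IH(2)] IH Suc.prems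
      unfolding eq[symmetric] by (simp add: algebra_simps minus_diff_commute)
  qed
  show ?thesis
    using up[of "nat n"] down[of "nat (- n)"] assms by (cases "n \<ge> 0") auto
qed

lemma cluster_var_nonzero: "cluster_var n \<noteq> 0"
  using has_weight_nonzero[OF has_weight_cluster_var[of n "nat (\<bar>n\<bar> + 1)"]] by simp

section \<open>Seeds, clusters and cluster monomials\<close>

lemma UNIV_vertex: "(UNIV :: vertex set) = {V1, V2}"
  by (auto intro: vertex.exhaust)

text \<open>Mutation at a vertex shifts the index of its variable by 2, so \<open>V1\<close> always
  carries an even index and \<open>V2\<close> an odd one.\<close>

definition cluster :: "int \<Rightarrow> vertex \<Rightarrow> ratfun2" where
  "cluster n = (if even n then case_vertex (cluster_var n) (cluster_var (n + 1))
                else case_vertex (cluster_var (n + 1)) (cluster_var n))"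

abbreviation kronecker_matrix :: "vertex \<Rightarrow> vertex \<Rightarrow> int" where
  "kronecker_matrix \<equiv> exchange_matrix kronecker"

lemma mutate_kronecker_matrix:
  assumes "b = kronecker_matrix \<or> b = - kronecker_matrix"
  shows "mutate_matrix k b = - b"
proof (intro ext)
  show "mutate_matrix k b i j = (- b) i j" for i j
    using assms by (cases i; cases j; cases k) (auto simp: mutate_matrix_def exchange_matrix_def)
qed

text \<open>One exchange product is a square and the other is 1; the sign of \<open>b\<close> only
  swaps them.\<close>

lemma mutate_cluster_kronecker:
  assumes "b = kronecker_matrix \<or> b = - kronecker_matrix"
  shows "mutate_cluster V1 b y = y(V1 := (y V2 ^ 2 + 1) / y V1)"
    and "mutate_cluster V2 b y = y(V2 := (y V1 ^ 2 + 1) / y V2)"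
  using assms by (auto simp: mutate_cluster_def exchange_matrix_def UNIV_vertex add.commute)

text \<open>The condition \<open>(k = V1) = even n\<close> says that \<open>k\<close> carries
  \<open>x_n\<close>. Replacing \<open>x_n\<close> moves the cluster forward, replacing
  \<open>x_(n+1)\<close> moves it back.\<close>

lemma mutate_cluster_eq_cluster:
  assumes b: "b = kronecker_matrix \<or> b = - kronecker_matrix"
  shows "mutate_cluster k b (cluster n) = cluster (if (k = V1) = even n then n + 1 else n - 1)"
proof -
  have succ: "((cluster_var (n + 1))\<^sup>2 + 1) / cluster_var n = cluster_var (2 + n)"
    using cluster_var_exchange[of "n + 1"] cluster_var_nonzero[of n] by (simp add: field_simps)
  have prev: "((cluster_var n)\<^sup>2 + 1) / cluster_var (n + 1) = cluster_var (n - 1)"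
    using cluster_var_exchange[of n] cluster_var_nonzero[of "n + 1"] by (simp add: field_simps)
  show ?thesis
  proof (rule ext)
    fix i
    show "mutate_cluster k b (cluster n) i = cluster (if (k = V1) = even n then n + 1 else n - 1) i"
      using succ prev
      by (cases k; cases i) (auto simp: mutate_cluster_kronecker[OF b] cluster_def)
  qed
qed

lemma seeds_kronecker:
  "S \<in> seeds kronecker_seed \<Longrightarrow>
     (fst S = kronecker_matrix \<or> fst S = - kronecker_matrix) \<and> snd S \<in> range cluster"
proof (induction rule: seeds.induct)
  case initial
  have "case_vertex u1 u2 = cluster 0"
    by (simp add: cluster_def cluster_var_0 cluster_var_1)
  then show ?case by (simp add: kronecker_seed_def)
next
  case (mutation S k)
  then obtain n where n: "snd S = cluster n" by blast
  have minus_minus_matrix: "- (- kronecker_matrix) = kronecker_matrix"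
    by (simp add: fun_eq_iff)
  have "mutate_seed k S = (- fst S, cluster (if (k = V1) = even n then n + 1 else n - 1))"
    using mutation.IH
    by (simp only: mutate_seed_def n mutate_kronecker_matrix mutate_cluster_eq_cluster)
  with mutation.IH show ?case
    by (elim conjE disjE)
      (simp_all only: fst_conv snd_conv minus_minus_matrix rangeI simp_thms)
qed

lemma cluster_in_seeds: "\<exists>S \<in> seeds kronecker_seed. snd S = cluster n"
proof -
  have step: "\<exists>S \<in> seeds kronecker_seed. snd S = cluster (if (k = V1) = even n then n + 1 else n - 1)"
    if "\<exists>S \<in> seeds kronecker_seed. snd S = cluster n" for n k
  proof -
    from that obtain S where S: "S \<in> seeds kronecker_seed" "snd S = cluster n" by blast
    then have "snd (mutate_seed k S) = cluster (if (k = V1) = even n then n + 1 else n - 1)"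
      using seeds_kronecker[OF S(1)] by (simp add: mutate_seed_def mutate_cluster_eq_cluster)
    with seeds.mutation[OF S(1)] show ?thesis by metis
  qed
  show ?thesis
  proof (induction n rule: int_induct[where k = 0])
    case base
    have "snd kronecker_seed = cluster 0"
      by (simp add: kronecker_seed_def cluster_def cluster_var_0 cluster_var_1)
    then show ?case using seeds.initial by blast
  next
    case (step1 n)
    from step[OF step1(2), of "if even n then V1 else V2"] show ?case by (simp split: if_splits)
  next
    case (step2 n)
    from step[OF step2(2), of "if even n then V2 else V1"] show ?case by (simp split: if_splits)
  qed
qed

lemma seeds_clusters: "snd ` seeds kronecker_seed = range cluster"
proof (intro subset_antisym subsetI)
  show "y \<in> range cluster" if "y \<in> snd ` seeds kronecker_seed" for y
    using that seeds_kronecker by blast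
  show "y \<in> snd ` seeds kronecker_seed" if "y \<in> range cluster" for y
  proof -
    from that obtain n where "y = cluster n" by blast
    then obtain S where "S \<in> seeds kronecker_seed" and y: "snd S = y"
      using cluster_in_seeds[of n] by blast
    from imageI[OF this(1), of snd] show ?thesis by (simp only: y)
  qed
qed

lemma cluster_variables_kronecker: "cluster_variables kronecker_seed = range cluster_var"
proof -
  have "cluster_variables kronecker_seed = (\<Union>y\<in>snd ` seeds kronecker_seed. range y)"
    by (simp add: cluster_variables_def)
  also have "\<dots> = (\<Union>n. range (cluster n))" by (simp add: seeds_clusters)
  also have "\<dots> = (\<Union>n. {cluster_var n, cluster_var (n + 1)})"
    by (auto simp: cluster_def UNIV_vertex)
  also have "\<dots> = range cluster_var" by auto
  finally show ?thesis .
qed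

lemma cluster_monomials_kronecker:
  "cluster_monomials kronecker_seed =
     {cluster_var n ^ i * cluster_var (n + 1) ^ j | n i j. True}" (is "_ = ?M")
proof -
  have collect: "{P (snd S) m | S m. S \<in> X} = (\<Union>y\<in>snd ` X. {P y m | m. True})"
    for P :: "(vertex \<Rightarrow> ratfun2) \<Rightarrow> (vertex \<Rightarrow> nat) \<Rightarrow> ratfun2" and X :: "(vertex, ratfun2) seed set"
    by blast
  have prod: "(\<Prod>i\<in>UNIV. y i ^ m i) = y V1 ^ m V1 * y V2 ^ m V2"
    for y :: "vertex \<Rightarrow> ratfun2" and m
    by (simp add: UNIV_vertex)
  have "cluster_monomials kronecker_seed = (\<Union>y\<in>snd ` seeds kronecker_seed. {y V1 ^ m V1 * y V2 ^ m V2 | m. True})"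
    unfolding cluster_monomials_def prod by (rule collect)
  also have "\<dots> = (\<Union>n. {cluster n V1 ^ m V1 * cluster n V2 ^ m V2 | m. True})"
    by (simp add: seeds_clusters)
  also have "\<dots> = ?M"
  proof (intro subset_antisym subsetI)
    fix w assume "w \<in> (\<Union>n. {cluster n V1 ^ m V1 * cluster n V2 ^ m V2 | m. True})"
    then obtain n m where "w = cluster n V1 ^ m V1 * cluster n V2 ^ m V2" by blast
    then have "w = cluster_var n ^ m V1 * cluster_var (n + 1) ^ m V2 \<or>
        w = cluster_var n ^ m V2 * cluster_var (n + 1) ^ m V1"
      by (cases "even n") (simp_all add: cluster_def mult.commute)
    then show "w \<in> ?M" by blast
  next
    fix w assume "w \<in> ?M"
    then obtain n i j where "w = cluster_var n ^ i * cluster_var (n + 1) ^ j" by blast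
    then have "w = cluster n V1 ^ case_vertex i j V1 * cluster n V2 ^ case_vertex i j V2 \<or>
        w = cluster n V1 ^ case_vertex j i V1 * cluster n V2 ^ case_vertex j i V2"
      by (cases "even n") (simp_all add: cluster_def mult.commute)
    then show "w \<in> (\<Union>n. {cluster n V1 ^ m V1 * cluster n V2 ^ m V2 | m. True})" by blast
  qed
  finally show ?thesis .
qed

text \<open>In degree \<open>d \<ge> 1\<close>, the cluster monomials \<open>x\<^sub>n\<^sup>i x\<^bsub>n+1\<^esub>\<^sup>j\<close> with \<open>i + j = d\<close> are indexed by the
  integer \<open>s = n d + j\<close>; the parameterization is not used for \<open>d = 0\<close>.\<close>

definition cluster_monomial :: "nat \<Rightarrow> int \<Rightarrow> ratfun2" where
  "cluster_monomial d s = cluster_var (s div int d) ^ (d - nat (s mod int d)) *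
     cluster_var (s div int d + 1) ^ nat (s mod int d)"

lemma cluster_monomial_eq:
  assumes "i + j > 0"
  obtains s where "cluster_var n ^ i * cluster_var (n + 1) ^ j = cluster_monomial (i + j) s"
proof (cases "i = 0")
  \<comment> \<open>Here \<open>j\<close> is the full degree and not a valid remainder, so the
    monomial is read as a power of the first variable of the cluster \<open>n + 1\<close>.\<close>
  case True
  with assms have "cluster_var n ^ i * cluster_var (n + 1) ^ j = cluster_monomial (i + j) ((n + 1) * int (i + j))"
    unfolding cluster_monomial_def by simp
  then show thesis by (rule that)
next
  case False
  define D where "D = int (i + j)"
  have D: "0 < D" "int j < D" using False by (auto simp: D_def)
  then have "(n * D + int j) div D = n" "(n * D + int j) mod D = int j"
    by (simp_all add: div_pos_pos_trivial)
  then have "cluster_var n ^ i * cluster_var (n + 1) ^ j = cluster_monomial (i + j) (n * D + int j)"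
    unfolding cluster_monomial_def D_def[symmetric] by simp
  then show thesis by (rule that)
qed

lemma cluster_monomials_kronecker_eq:
  "cluster_monomials kronecker_seed = insert 1 {cluster_monomial (Suc d) s | d s. True}"
proof (intro subset_antisym subsetI)
  fix w assume "w \<in> cluster_monomials kronecker_seed"
  then obtain n i j where w: "w = cluster_var n ^ i * cluster_var (n + 1) ^ j"
    unfolding cluster_monomials_kronecker by blast
  show "w \<in> insert 1 {cluster_monomial (Suc d) s | d s. True}"
  proof (cases "i + j = 0")
    case False
    then have "0 < i + j" by simp
    then obtain s where "w = cluster_monomial (i + j) s" unfolding w by (rule cluster_monomial_eq)
    moreover obtain d where "i + j = Suc d" using False not0_implies_Suc by blast
    ultimately show ?thesis by auto
  qed (simp add: w)
next
  fix w assume "w \<in> insert 1 {cluster_monomial (Suc d) s | d s. True}"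
  then consider "w = 1" | d s where "w = cluster_monomial (Suc d) s" by blast
  then have "\<exists>n i j. w = cluster_var n ^ i * cluster_var (n + 1) ^ j"
  proof cases
    case 1
    then have "w = cluster_var 0 ^ 0 * cluster_var (0 + 1) ^ 0" by simp
    then show ?thesis by (intro exI)
  next
    case 2
    then show ?thesis unfolding cluster_monomial_def by (intro exI)
  qed
  then show "w \<in> cluster_monomials kronecker_seed" unfolding cluster_monomials_kronecker by blast
qed

text \<open>Weights add up to \<open>N d + (n d + j)\<close>. With remainder 0 only
  \<open>x_n\<close> occurs, and this case is separate because \<open>n + 1\<close> may then reach
  \<open>N\<close>.\<close>

lemma has_weight_cluster_monomial:
  assumes "\<bar>s\<bar> < int N"
  shows "has_weight N (cluster_monomial (Suc d) s) (int N * int (Suc d) + s)"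
proof (cases "s mod int (Suc d) = 0")
  case True
  define n where "n = s div int (Suc d)"
  have s: "s = n * int (Suc d)" using True by (simp add: n_def minus_mod_eq_div_mult[symmetric])
  then have "\<bar>n\<bar> * 1 \<le> \<bar>s\<bar>" unfolding s abs_mult by (intro mult_left_mono) auto
  with assms have "has_weight N (cluster_var n) (int N + n)" by (intro has_weight_cluster_var) simp
  from has_weight_power[OF this, of "Suc d"] show ?thesis
    unfolding cluster_monomial_def True n_def[symmetric] by (simp add: s algebra_simps)
next
  case False
  define n where "n = s div int (Suc d)"
  define j where "j = nat (s mod int (Suc d))"
  have j: "int j = s mod int (Suc d)" "0 < j" "j < Suc d" using False
    using pos_mod_sign[of "int (Suc d)" s] pos_mod_bound[of "int (Suc d)" s]
    unfolding j_def by linarith+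
  have s: "s = n * int (Suc d) + int j" by (simp only: j n_def div_mult_mod_eq)
  have "\<bar>n\<bar> < int N \<and> \<bar>n + 1\<bar> < int N"
  proof (cases "n \<ge> 0")
    case True
    then have "n * 1 \<le> n * int (Suc d)" by (intro mult_left_mono) auto
    with s j(2) True assms show ?thesis by linarith
  next
    case False
    define D where "D = int (Suc d)"
    define P where "P = (n + 1) * D"
    \<comment> \<open>As \<open>n + 1\<close> is at most 0, multiplying it by \<open>D\<close> can
      only decrease it; with \<open>j < D\<close> this gives \<open>s \<le> n < 0\<close>.\<close>
    from False have "P \<le> (n + 1) * 1"
      unfolding P_def by (intro mult_left_mono_neg) (auto simp: D_def)
    moreover have "s = P - (D - int j)"
      by (simp add: s P_def D_def algebra_simps)
    moreover have "D - int j \<ge> 1" using j(3) by (simp add: D_def)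
    ultimately have "s \<le> n" by simp
    with False assms show ?thesis by simp
  qed
  then have "has_weight N (cluster_var n) (int N + n)" "has_weight N (cluster_var (n + 1)) (int N + (n + 1))"
    using has_weight_cluster_var by blast+
  from has_weight_mult[OF has_weight_power[OF this(1), of "Suc d - j"] has_weight_power[OF this(2), of j]]
  have "has_weight N (cluster_monomial (Suc d) s)
      (int (Suc d - j) * (int N + n) + int j * (int N + (n + 1)))"
    by (simp only: cluster_monomial_def n_def j_def)
  moreover have "int (Suc d - j) = int (Suc d) - int j" using j by simp
  ultimately show ?thesis by (simp add: s algebra_simps)
qed

section \<open>The cluster algebra as the span of the semicanonical basis\<close>

abbreviation semicanonical_span :: "ratfun2 set" where
  "semicanonical_span \<equiv> zmod.span semicanonical_basis"

lemma cluster_power_product_in_span: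
  "cluster_var n ^ i * cluster_var (n + 1) ^ j \<in> semicanonical_span"
  by (rule zmod.span_base) (auto simp: semicanonical_basis_def cluster_monomials_kronecker)

lemma span_mult_closed:
  assumes "\<And>w. w \<in> B \<Longrightarrow> v * w \<in> zmod.span B" and "w \<in> zmod.span B"
  shows "v * w \<in> zmod.span B"
  using assms(2)
proof (induction rule: zmod.span_induct_alt)
  case base
  then show ?case by (simp add: zmod.span_zero)
next
  case (step c x y)
  have "of_int c * (v * x) + v * y \<in> zmod.span B"
    using step assms(1) by (intro zmod.span_add zmod.span_scale)
  then show ?case by (simp add: algebra_simps)
qed

text \<open>If one variable occurs, the linear relation replaces \<open>z\<close> times it by its
  two neighbours; if both occur, the quadratic relation rewrites \<open>z x_n x_(n+1)\<close>. Each
  resulting product again involves only two consecutive variables.\<close>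

lemma z_mult_in_span: "w \<in> semicanonical_span \<Longrightarrow> z * w \<in> semicanonical_span"
proof (rule span_mult_closed)
  fix w assume "w \<in> semicanonical_basis"
  then consider n i j where "w = cluster_var n ^ i * cluster_var (n + 1) ^ j" | n where "w = z ^ n"
    unfolding semicanonical_basis_def cluster_monomials_kronecker by blast
  then show "z * w \<in> semicanonical_span"
  proof cases
    case 2
    then have "z * w = z ^ Suc n" by simp
    moreover have "z ^ Suc n \<in> semicanonical_basis" unfolding semicanonical_basis_def
      by (rule UnI2, rule CollectI, rule exI[of _ "Suc n"]) simp
    ultimately show ?thesis by (simp only: zmod.span_base)
  next
    case 1
    note in_span = cluster_power_product_in_span
    have z_succ: "z * cluster_var (n + 1) = cluster_var n + cluster_var (n + 2)"
      using cluster_var_linear[of "n + 1"] by (simp add: add.commute)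
    consider "i = 0" "j = 0" | i' where "i = Suc i'" "j = 0" | j' where "i = 0" "j = Suc j'"
      | i' j' where "i = Suc i'" "j = Suc j'" by (cases i; cases j) auto
    then show ?thesis
    proof cases
      case 1
      have "z ^ 1 \<in> semicanonical_basis" unfolding semicanonical_basis_def by blast
      with 1 \<open>w = _\<close> show ?thesis by (auto intro: zmod.span_base)
    next
      case (2 i')
      then have "z * w = (cluster_var (n - 1) + cluster_var (n + 1)) * cluster_var n ^ i'"
        unfolding cluster_var_linear \<open>w = _\<close> by simp
      then have "z * w = cluster_var (n - 1) ^ 1 * cluster_var (n - 1 + 1) ^ i' +
          cluster_var n ^ i' * cluster_var (n + 1) ^ 1"
        by (simp add: algebra_simps)
      then show ?thesis by (simp only:) (intro zmod.span_add in_span)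
    next
      case (3 j')
      then have "z * w = (z * cluster_var (n + 1)) * cluster_var (n + 1) ^ j'"
        unfolding \<open>w = _\<close> by simp
      then have "z * w = cluster_var n ^ 1 * cluster_var (n + 1) ^ j' +
          cluster_var (n + 1) ^ j' * cluster_var (n + 1 + 1) ^ 1"
        unfolding z_succ by (simp add: algebra_simps)
      then show ?thesis by (simp only:) (intro zmod.span_add in_span)
    next
      case (4 i' j')
      then have "z * w = (z * cluster_var n * cluster_var (n + 1)) * (cluster_var n ^ i' * cluster_var (n + 1) ^ j')"
        using \<open>w = _\<close> by (simp add: algebra_simps)
      also have "\<dots> = cluster_var n ^ (i' + 2) * cluster_var (n + 1) ^ j' +
          cluster_var n ^ i' * cluster_var (n + 1) ^ (j' + 2) + cluster_var n ^ i' * cluster_var (n + 1) ^ j'"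
        unfolding cluster_var_quadratic[symmetric] by (simp add: power2_eq_square algebra_simps)
      finally show ?thesis by (simp only:) (intro zmod.span_add in_span)
    qed
  qed
qed

text \<open>The linear recursion propagates membership from two neighbouring indices in both
  directions, by stability under \<open>z\<close>.\<close>

lemma cluster_var_mult_in_span:
  assumes "cluster_var n * w \<in> semicanonical_span" "cluster_var (n + 1) * w \<in> semicanonical_span"
  shows "cluster_var m * w \<in> semicanonical_span"
proof -
  have "cluster_var m * w \<in> semicanonical_span \<and> cluster_var (m + 1) * w \<in> semicanonical_span"
  proof (induction m rule: int_induct[where k = n])
    case base
    show ?case using assms by simp
  next
    case (step1 m)
    have "cluster_var (m + 1 + 1) * w = z * (cluster_var (m + 1) * w) - cluster_var m * w"
      by (simp only: cluster_var_succ[of "m + 1"] add_diff_cancel_right' left_diff_distrib mult.assoc)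
    with step1 show ?case by (simp add: z_mult_in_span zmod.span_diff)
  next
    case (step2 m)
    have "cluster_var (m - 1) * w = z * (cluster_var m * w) - cluster_var (m + 1) * w"
      by (simp only: cluster_var_pred left_diff_distrib mult.assoc)
    with step2 show ?case by (simp add: z_mult_in_span zmod.span_diff)
  qed
  then show ?thesis ..
qed

text \<open>A monomial in \<open>x_n\<close>, \<open>x_(n+1)\<close> stays one when multiplied by
  either of them, which suffices for every \<open>x_m\<close>. For \<open>z ^ n\<close>, start from
  \<open>x_m\<close> and multiply by \<open>z\<close> repeatedly.\<close>

lemma cluster_var_times_span:
  "w \<in> semicanonical_span \<Longrightarrow> cluster_var m * w \<in> semicanonical_span"
proof (rule span_mult_closed)
  fix w assume "w \<in> semicanonical_basis"
  then consider n i j where "w = cluster_var n ^ i * cluster_var (n + 1) ^ j" | n where "w = z ^ n"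
    unfolding semicanonical_basis_def cluster_monomials_kronecker by blast
  then show "cluster_var m * w \<in> semicanonical_span"
  proof cases
    case 1
    have "cluster_var n * w = cluster_var n ^ Suc i * cluster_var (n + 1) ^ j"
      "cluster_var (n + 1) * w = cluster_var n ^ i * cluster_var (n + 1) ^ Suc j"
      using 1 by (simp_all add: algebra_simps)
    then show ?thesis
      by - (rule cluster_var_mult_in_span[of n], simp_all only: cluster_power_product_in_span)
  next
    case 2
    have "z ^ n * cluster_var m \<in> semicanonical_span"
    proof (induction n)
      case 0
      then show ?case using cluster_power_product_in_span[of m 1 0] by simp
    next
      case (Suc n)
      from z_mult_in_span[OF this] show ?case by (simp add: mult.assoc)
    qed
    with 2 show ?thesis by (simp add: mult.commute)
  qed
qed

lemma cluster_algebra_kronecker: "cluster_algebra kronecker_seed = semicanonical_span"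
proof (intro subset_antisym subsetI)
  fix v assume v: "v \<in> cluster_algebra kronecker_seed"
  \<comment> \<open>Stability of the span under \<open>v\<close> is an invariant compatible with
    products; membership of \<open>v\<close> follows by applying it to 1.\<close>
  then have "\<forall>w\<in>semicanonical_span. v * w \<in> semicanonical_span"
  proof induction
    case (variable x)
    then show ?case by (auto simp: cluster_variables_kronecker cluster_var_times_span)
  next
    case (diff x y)
    then show ?case by (auto simp: left_diff_distrib zmod.span_diff)
  next
    case (mult x y)
    then show ?case by (auto simp: mult.assoc)
  qed simp
  moreover have "1 \<in> semicanonical_span" using cluster_power_product_in_span[of 0 0 0] by simp
  ultimately show "v \<in> semicanonical_span" by force
next
  note closed = cluster_algebra.intros
  have zero: "0 \<in> cluster_algebra kronecker_seed"
    using closed(3)[OF closed(2) closed(2)] by simp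
  have add: "x + y \<in> cluster_algebra kronecker_seed"
    if "x \<in> cluster_algebra kronecker_seed" "y \<in> cluster_algebra kronecker_seed" for x y
    using closed(3)[OF that(1) closed(3)[OF zero that(2)]] by simp
  have of_nat: "of_nat n \<in> cluster_algebra kronecker_seed" for n
    by (induction n) (auto intro: zero closed(2) add)
  have of_int: "of_int c \<in> cluster_algebra kronecker_seed" for c
    using of_nat closed(3)[OF zero of_nat] by (cases c rule: int_cases2) auto
  have power: "x ^ n \<in> cluster_algebra kronecker_seed" if "x \<in> cluster_algebra kronecker_seed" for x n
    by (induction n) (auto intro: closed(2,4) that)
  have var: "cluster_var n \<in> cluster_algebra kronecker_seed" for n
    by (rule closed(1)) (simp add: cluster_variables_kronecker)
  \<comment> \<open>The remaining point is that \<open>z\<close> is a polynomial in cluster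
    variables: \<open>z = x_(-1) x_2 - x_0 x_1\<close>.\<close>
  have "cluster_var (- 1) * cluster_var 2 =
      (z * cluster_var 0 - cluster_var 1) * (z * cluster_var 1 - cluster_var 0)"
    using cluster_var_pred[of 0] cluster_var_succ[of 1] by simp
  also have "\<dots> = z * (z * cluster_var 0 * cluster_var 1 - (cluster_var 0)\<^sup>2 - (cluster_var 1)\<^sup>2) +
      cluster_var 0 * cluster_var 1"
    by (simp add: power2_eq_square algebra_simps)
  also have "z * cluster_var 0 * cluster_var 1 - (cluster_var 0)\<^sup>2 - (cluster_var 1)\<^sup>2 = 1"
    using cluster_var_quadratic[of 0] by (simp add: algebra_simps)
  finally have z_eq: "z = cluster_var (- 1) * cluster_var 2 - cluster_var 0 * cluster_var 1"
    by simp
  have z: "z \<in> cluster_algebra kronecker_seed"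
    by (subst z_eq) (intro closed(3,4) var)
  fix v assume "v \<in> semicanonical_span"
  then show "v \<in> cluster_algebra kronecker_seed"
  proof (induction rule: zmod.span_induct_alt)
    case (step c x y)
    then have "x \<in> cluster_algebra kronecker_seed"
      by (auto simp: semicanonical_basis_def cluster_monomials_kronecker intro: closed power var z)
    with step of_int show ?case by (auto intro: add closed)
  qed (rule zero)
qed

section \<open>Unitriangular base changes\<close>

text \<open>Relations are indexed by positions, so a repeated value would give one with coefficients
  1 and -1.\<close>

lemma no_relation_imp_independent:
  fixes f :: "nat \<Rightarrow> 'f::field"
  assumes no_relation: "\<And>J c. finite J \<Longrightarrow> (\<Sum>j\<in>J. of_int (c j) * f j) = 0 \<Longrightarrow> \<forall>j\<in>J. c j = 0"
  shows "inj f" and "zmod.independent (range f)"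
proof -
  show inj: "inj f"
  proof (rule injI, rule ccontr)
    fix i j assume "f i = f j" "i \<noteq> j"
    then have "(\<Sum>k\<in>{i, j}. of_int (if k = i then 1 else - 1) * f k) = 0" by simp
    from no_relation[OF _ this] show False by simp
  qed
  show "zmod.independent (range f)"
    unfolding zmod.independent_explicit_module
  proof (intro allI impI)
    fix t and u :: "'f \<Rightarrow> int" and v
    assume t: "finite t" "t \<subseteq> range f" and sum: "(\<Sum>v\<in>t. of_int (u v) * v) = 0" and v: "v \<in> t"
    obtain J where J: "t = f ` J" "finite J" using t finite_subset_image by metis
    have "inj_on f J" using inj by (rule inj_on_subset) simp
    then have "(\<Sum>j\<in>J. of_int (u (f j)) * f j) = 0"
      using sum by (simp add: J sum.reindex)
    from no_relation[OF J(2) this] show "u v = 0" using v J by blast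
  qed
qed

text \<open>Each factor moves the support one more diagonal up, so the \<open>n\<close>-th power
  vanishes.\<close>

lemma strictly_upper_triangular_power:
  fixes U :: "int mat"
  assumes U: "U \<in> carrier_mat n n" and zero: "\<And>i j. j \<le> i \<Longrightarrow> i < n \<Longrightarrow> U $$ (i, j) = 0"
  shows "i < n \<Longrightarrow> j < n \<Longrightarrow> j < i + m \<Longrightarrow> (U ^\<^sub>m m) $$ (i, j) = 0"
proof (induction m arbitrary: i j)
  case 0
  with U show ?case by simp
next
  case (Suc m)
  have dim: "dim_row (U ^\<^sub>m m) = n" "dim_col (U ^\<^sub>m m) = n" using U by auto
  have "(U ^\<^sub>m m) $$ (i, l) * U $$ (l, j) = 0" if "l < n" for l
    using Suc.IH[of i l] zero[of j l] that Suc.prems by (cases "l < i + m") auto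
  then have "(\<Sum>l = 0..<n. (U ^\<^sub>m m) $$ (i, l) * U $$ (l, j)) = 0"
    by (intro sum.neutral) simp
  moreover have "(U ^\<^sub>m Suc m) $$ (i, j) = (\<Sum>l = 0..<n. (U ^\<^sub>m m) $$ (i, l) * U $$ (l, j))"
    using Suc.prems U dim by (simp add: scalar_prod_def)
  ultimately show ?case by simp
qed

lemma unitriangular_imp_unipotent:
  assumes T: "T \<in> carrier_mat n n" and "\<And>i. i < n \<Longrightarrow> T $$ (i, i) = 1"
    and "\<And>i j. j < i \<Longrightarrow> i < n \<Longrightarrow> T $$ (i, j) = 0"
  shows "unipotent_mat T"
proof -
  define U where "U = T - 1\<^sub>m n"
  have U: "U \<in> carrier_mat n n" by (simp add: U_def minus_carrier_mat)
  have "U $$ (i, j) = 0" if "j \<le> i" "i < n" for i j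
    using that assms by (cases "i = j") (auto simp: U_def)
  from strictly_upper_triangular_power[OF U this] have "U ^\<^sub>m n = 0\<^sub>m n n"
    using U by (intro eq_matI) auto
  then show ?thesis
    using T by (auto simp: unipotent_mat_def U_def)
qed

text \<open>The unit diagonal lets each \<open>a k\<close> be solved for in terms of
  \<open>b k\<close> and earlier \<open>a j\<close>, without division; independence identifies the
  coordinates with \<open>T\<close>.\<close>

lemma unitriangular_base_change:
  fixes a b :: "nat \<Rightarrow> 'f::field" and T :: "nat \<Rightarrow> nat \<Rightarrow> int"
  assumes a: "inj a" "zmod.independent (range a)"
    and b: "\<And>k. b k = (\<Sum>j\<le>k. of_int (T j k) * a j)"
    and diag: "\<And>k. T k k = 1" and upper: "\<And>j k. k < j \<Longrightarrow> T j k = 0"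
  shows "zmod.span (a ` {..n}) = zmod.span (b ` {..n})"
    and "base_change_matrix a b n = mat (Suc n) (Suc n) (\<lambda>(j, k). T j k)"
    and "unipotent_mat (base_change_matrix a b n)"
proof -
  have b_in: "b k \<in> zmod.span (a ` {..n})" if "k \<le> n" for k
    unfolding b using that by (intro zmod.span_sum zmod.span_scale zmod.span_base) auto
  have a_in: "k \<le> n \<Longrightarrow> a k \<in> zmod.span (b ` {..n})" for k
  proof (induction k rule: less_induct)
    case (less k)
    have "b k = (\<Sum>j<k. of_int (T j k) * a j) + a k"
      by (simp add: b[of k] diag flip: lessThan_Suc_atMost)
    then have "a k = b k - (\<Sum>j<k. of_int (T j k) * a j)" by simp
    also have "\<dots> \<in> zmod.span (b ` {..n})"
      using less by (intro zmod.span_diff zmod.span_sum zmod.span_scale) (auto intro: zmod.span_base)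
    finally show ?case .
  qed
  show "zmod.span (a ` {..n}) = zmod.span (b ` {..n})"
    unfolding zmod.span_eq using a_in b_in by auto
  have indep: "zmod.independent (a ` {..n})"
    using a(2) by (rule zmod.independent_mono) auto
  have rep: "zmod.representation (a ` {..n}) (b k) (a j) = T j k" if "j \<le> n" "k \<le> n" for j k
  proof -
    have scaled: "zmod.representation (a ` {..n}) (of_int c * a i) (a j) = c * (if j = i then 1 else 0)"
      if "i \<le> n" for i c
    proof -
      have "a i \<in> a ` {..n}" using that by simp
      from zmod.representation_scale[OF indep zmod.span_base[OF this], of c]
        zmod.representation_basis[OF indep this]
      show ?thesis using a(1) by (simp add: inj_eq)
    qed
    have "zmod.representation (a ` {..n}) (b k) (a j) =
        (\<Sum>i\<le>k. T i k * (if j = i then 1 else 0))"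
      unfolding b using \<open>k \<le> n\<close>
      by (subst zmod.representation_sum[OF indep])
         (auto simp: scaled intro!: zmod.span_scale intro: zmod.span_base)
    also have "\<dots> = T j k"
      \<comment> \<open>For \<open>j > k\<close> the sum has no matching index, and
        \<open>upper\<close> makes \<open>T j k\<close> zero as well.\<close>
      using upper[of k j] by (simp add: sum.delta' not_le if_distrib cong: if_cong)
    finally show ?thesis .
  qed
  show matrix: "base_change_matrix a b n = mat (Suc n) (Suc n) (\<lambda>(j, k). T j k)"
    unfolding base_change_matrix_def by (intro eq_matI) (auto simp: rep)
  show "unipotent_mat (base_change_matrix a b n)"
    unfolding matrix
    by (rule unitriangular_imp_unipotent[of _ "Suc n"]) (auto simp: diag upper)
qed

text \<open>The coefficients of \<open>x\<^sup>k\<close> in the Chebyshev polynomials, by \<open>x C\<^sub>j = C\<^bsub>j+1\<^esub> + C\<^bsub>j-1\<^esub>\<close>.\<close>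

fun power_coeff :: "nat \<Rightarrow> nat \<Rightarrow> int" where
  "power_coeff 0 j = (if j = 0 then 1 else 0)"
| "power_coeff (Suc k) j = (case j of 0 \<Rightarrow> 0 | Suc i \<Rightarrow> power_coeff k i) + power_coeff k (Suc j)"

lemma power_coeff_nonneg: "power_coeff k j \<ge> 0"
  by (induction k arbitrary: j) (auto split: nat.split)

lemma power_coeff_eq_0: "k < j \<Longrightarrow> power_coeff k j = 0"
  by (induction k arbitrary: j) (auto split: nat.split)

lemma power_coeff_diag: "power_coeff k k = 1"
  by (induction k) (auto simp: power_coeff_eq_0)

lemma power_eq_sum_chebyshev:
  fixes x :: "'a::comm_ring_1"
  shows "x ^ k = (\<Sum>j\<le>k. of_int (power_coeff k j) * chebyshev j x)"
proof (induction k)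
  case (Suc k)
  let ?w = "\<lambda>j. of_int (power_coeff k j) :: 'a" and ?C = "\<lambda>j. chebyshev j x"
  \<comment> \<open>The value 0 at index 0 plays the part of \<open>C_(-1) = 0\<close>.\<close>
  let ?prev = "case_nat 0 ?C"
  have step: "x * ?C j = ?C (Suc j) + ?prev j" for j
    by (cases j) simp_all
  have "x ^ Suc k = (\<Sum>j\<le>k. ?w j * (?C (Suc j) + ?prev j))"
    unfolding power_Suc Suc sum_distrib_left
    by (intro sum.cong refl) (simp only: mult.left_commute[of x] step)
  also have "\<dots> = (\<Sum>j\<le>k. ?w j * ?C (Suc j)) + (\<Sum>j\<le>k. ?w j * ?prev j)"
    by (simp add: distrib_left sum.distrib)
  also have "(\<Sum>j\<le>k. ?w j * ?C (Suc j)) = (\<Sum>j\<le>Suc k. case_nat 0 ?w j * ?C j)"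
    by (subst sum.atMost_Suc_shift) simp
  \<comment> \<open>The added top term vanishes because \<open>power_coeff k\<close> is zero above
    \<open>k\<close>; this aligns both sums to the range up to \<open>Suc k\<close>.\<close>
  also have "(\<Sum>j\<le>k. ?w j * ?prev j) = (\<Sum>j\<le>Suc k. ?w j * ?prev j)"
    by (simp add: power_coeff_eq_0)
  also have "\<dots> = (\<Sum>j\<le>k. ?w (Suc j) * ?C j)"
    by (subst sum.atMost_Suc_shift) simp
  also have "\<dots> = (\<Sum>j\<le>Suc k. ?w (Suc j) * ?C j)"
    by (simp add: power_coeff_eq_0)
  also have "(\<Sum>j\<le>Suc k. case_nat 0 ?w j * ?C j) + \<dots> =
      (\<Sum>j\<le>Suc k. of_int (power_coeff (Suc k) j) * ?C j)"
    unfolding sum.distrib[symmetric]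
    by (intro sum.cong refl) (simp add: distrib_right split: nat.split)
  finally show ?case .
qed simp

text \<open>The regular elements \<open>g k\<close> take the even positions, in increasing order of \<open>k\<close>, and the
  nontrivial cluster monomials the odd ones.\<close>

definition enumeration :: "(nat \<Rightarrow> ratfun2) \<Rightarrow> nat \<Rightarrow> ratfun2" where
  "enumeration g n = (if even n then g (n div 2)
     else case prod_decode (n div 2) of (d, s) \<Rightarrow> cluster_monomial (Suc d) (int_decode s))"

lemma enumeration_even: "enumeration g (2 * k) = g k"
  by (simp add: enumeration_def)

lemma enumeration_odd: "enumeration g (Suc (2 * prod_encode (d, int_encode s))) = cluster_monomial (Suc d) s"
  by (simp add: enumeration_def)

text \<open>The trivial monomial 1 sits at position 0 through \<open>g 0 = 1\<close>; the odd
  positions supply all monomials of positive degree.\<close>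

lemma range_enumeration:
  assumes "g 0 = 1"
  shows "range (enumeration g) = cluster_monomials kronecker_seed \<union> {g n | n. n \<ge> 1}"
proof (intro subset_antisym subsetI)
  fix w assume "w \<in> range (enumeration g)"
  then obtain n where w: "w = enumeration g n" by blast
  show "w \<in> cluster_monomials kronecker_seed \<union> {g n | n. n \<ge> 1}"
  proof (cases "even n")
    case True
    then have "w = g (n div 2)" by (simp add: w enumeration_def)
    then show ?thesis
      using assms by (cases "n div 2 = 0") (auto simp: cluster_monomials_kronecker_eq)
  next
    case False
    then show ?thesis
      by (auto simp: w enumeration_def cluster_monomials_kronecker_eq split: prod.split)
  qed
next
  fix w assume "w \<in> cluster_monomials kronecker_seed \<union> {g n | n. n \<ge> 1}"
  then consider "w = 1" | d s where "w = cluster_monomial (Suc d) s" | k where "w = g k"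
    unfolding cluster_monomials_kronecker_eq by blast
  then show "w \<in> range (enumeration g)"
    by cases (metis assms enumeration_even enumeration_odd rangeI)+
qed

lemma enumeration_no_relation:
  assumes weight: "\<And>N k. has_weight N (g k) (int k)"
    and "finite J" "(\<Sum>j\<in>J. of_int (c j) * enumeration g j) = 0"
  shows "\<forall>j\<in>J. c j = 0"
proof -
  \<comment> \<open>The leading monomial is \<open>u1^d t^s\<close>: \<open>d = 0\<close> marks the
    regular elements, and \<open>d\<close> is positive for the other cluster monomials.\<close>
  define d where "d n = (if even n then 0 else int (Suc (fst (prod_decode (n div 2)))))" for n :: nat
  define s where "s n = (if even n then int (n div 2) else int_decode (snd (prod_decode (n div 2))))" for n :: nat
  have "has_weight N (enumeration g j) (int N * d j + s j)" if "\<bar>s j\<bar> < int N" for N j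
  proof (cases "even j")
    case True
    then show ?thesis using weight by (simp add: enumeration_def d_def s_def)
  next
    case False
    with that has_weight_cluster_monomial[of "s j" N "fst (prod_decode (j div 2))"]
    show ?thesis by (simp add: enumeration_def d_def s_def case_prod_unfold)
  qed
  moreover have "inj (\<lambda>j. (d j, s j))"
  proof (rule injI)
    fix i j assume eq: "(d i, s i) = (d j, s j)"
    then have even_iff: "even i \<longleftrightarrow> even j" by (auto simp: d_def split: if_splits)
    have "i div 2 = j div 2"
    proof (cases "even i")
      case True
      with eq even_iff show ?thesis by (simp add: s_def)
    next
      case False
      with eq even_iff have "fst (prod_decode (i div 2)) = fst (prod_decode (j div 2))"
        "int_decode (snd (prod_decode (i div 2))) = int_decode (snd (prod_decode (j div 2)))"
        by (simp_all add: s_def d_def)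
      then have "prod_decode (i div 2) = prod_decode (j div 2)"
        by (simp add: prod_eq_iff int_decode_eq)
      then show ?thesis by (simp only: prod_decode_eq)
    qed
    moreover have "i mod 2 = j mod 2" using even_iff by (simp add: parity_cases mod2_eq_if)
    ultimately show "i = j" by (metis div_mult_mod_eq)
  qed
  ultimately show ?thesis using weights_imp_no_relation assms(2,3) by blast
qed

text \<open>Chebyshev coefficients on the even positions and the identity on the odd ones;
  \<open>j\<close> is the row and \<open>n\<close> the column.\<close>

definition transition_coeff :: "nat \<Rightarrow> nat \<Rightarrow> int" where
  "transition_coeff j n = (if even j \<and> even n then power_coeff (n div 2) (j div 2)
     else if j = n then 1 else 0)"

lemma enumeration_transition:
  assumes "\<And>k. h k = (\<Sum>j\<le>k. of_int (power_coeff k j) * g j)"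
  shows "enumeration h n = (\<Sum>j\<le>n. of_int (transition_coeff j n) * enumeration g j)"
proof (cases "even n")
  case True
  then obtain k where n: "n = 2 * k" by blast
  have "(\<Sum>j\<le>n. of_int (transition_coeff j n) * enumeration g j) =
      (\<Sum>j\<in>(*) 2 ` {..k}. of_int (transition_coeff j n) * enumeration g j)"
    by (intro sum.mono_neutral_right) (auto simp: n transition_coeff_def image_iff elim!: evenE)
  also have "\<dots> = (\<Sum>j\<le>k. of_int (power_coeff k j) * g j)"
    by (subst sum.reindex) (auto simp: inj_on_def n transition_coeff_def enumeration_even)
  finally show ?thesis using assms by (simp add: n enumeration_even)
next
  case False
  have "(\<Sum>j\<le>n. of_int (transition_coeff j n) * enumeration g j) =
      (\<Sum>j\<le>n. if j = n then enumeration g j else 0)"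
    using False by (intro sum.cong) (auto simp: transition_coeff_def)
  also have "\<dots> = enumeration g n" by simp
  finally show ?thesis using False by (simp add: enumeration_def)
qed

theorem proposition5p9:
  shows "\<exists>a b. bij_betw a UNIV caldero_zelevinsky_basis \<and> bij_betw b UNIV semicanonical_basis \<and>
           positive_locally_unipotent_base_change (cluster_algebra kronecker_seed) a b"
proof -
  define a where "a = enumeration (\<lambda>k. chebyshev k z)"
  define b where "b = enumeration (\<lambda>k. z ^ k)"
  have no_relation_a: "\<forall>j\<in>J. c j = 0" if "finite J" "(\<Sum>j\<in>J. of_int (c j) * a j) = 0" for J c
    using enumeration_no_relation[of "\<lambda>k. chebyshev k z" J c] that by (simp add: a_def has_weight_chebyshev)
  have a: "inj a" "zmod.independent (range a)"
    by (rule no_relation_imp_independent; rule no_relation_a; assumption)+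
  have no_relation_b: "\<forall>j\<in>J. c j = 0" if "finite J" "(\<Sum>j\<in>J. of_int (c j) * b j) = 0" for J c
    using enumeration_no_relation[of "\<lambda>k. z ^ k" J c] that by (simp add: b_def has_weight_z_power)
  have b: "inj b" "zmod.independent (range b)"
    by (rule no_relation_imp_independent; rule no_relation_b; assumption)+
  have range_a: "range a = caldero_zelevinsky_basis"
    by (simp add: a_def range_enumeration caldero_zelevinsky_basis_def)
  have range_b: "range b = semicanonical_basis"
    by (simp add: b_def range_enumeration semicanonical_basis_def)
  have b_eq: "b n = (\<Sum>j\<le>n. of_int (transition_coeff j n) * a j)" for n
    unfolding a_def b_def by (rule enumeration_transition) (rule power_eq_sum_chebyshev)
  have diag: "transition_coeff k k = 1" for k
    by (simp add: transition_coeff_def power_coeff_diag)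
  have upper: "transition_coeff j k = 0" if "k < j" for j k
    using that by (auto simp: transition_coeff_def intro!: power_coeff_eq_0 elim!: evenE)
  have nonneg: "transition_coeff j k \<ge> 0" for j k
    by (simp add: transition_coeff_def power_coeff_nonneg)
  have change: "zmod.span (a ` {..n}) = zmod.span (b ` {..n})"
    "base_change_matrix a b n = mat (Suc n) (Suc n) (\<lambda>(j, k). transition_coeff j k)"
    "unipotent_mat (base_change_matrix a b n)" for n
    by (rule unitriangular_base_change[of a b transition_coeff, OF a b_eq diag]; erule upper)+
  \<comment> \<open>Every basis element lies in a finite initial segment, so the local equalities of
    spans give the global one; it transfers the spanning property from \<open>b\<close> to
    \<open>a\<close>.\<close>
  have spans: "zmod.span (range a) = zmod.span (range b)"
  proof -
    have "a n \<in> zmod.span (range b)" for n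
    proof -
      have "a n \<in> zmod.span (b ` {..n})"
        unfolding change(1)[symmetric] by (rule zmod.span_base) simp
      then show ?thesis by (rule subsetD[OF zmod.span_mono, rotated]) auto
    qed
    moreover have "b n \<in> zmod.span (range a)" for n
    proof -
      have "b n \<in> zmod.span (a ` {..n})"
        unfolding change(1) by (rule zmod.span_base) simp
      then show ?thesis by (rule subsetD[OF zmod.span_mono, rotated]) auto
    qed
    ultimately show ?thesis unfolding zmod.span_eq by (intro conjI image_subsetI)
  qed
  have "enumerated_basis (cluster_algebra kronecker_seed) a"
    "enumerated_basis (cluster_algebra kronecker_seed) b"
    using a b spans by (simp_all add: enumerated_basis_def cluster_algebra_kronecker range_b)
  then have "positive_locally_unipotent_base_change (cluster_algebra kronecker_seed) a b"
    unfolding positive_locally_unipotent_base_change_def locally_unipotent_base_change_def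
    using change(1,3) by (auto simp: change(2) nonneg)
  moreover have "bij_betw a UNIV caldero_zelevinsky_basis" "bij_betw b UNIV semicanonical_basis"
    using a(1) b(1) range_a range_b by (simp_all add: bij_betw_def)
  ultimately show ?thesis by blast
qed

end
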